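(* Let $\varepsilon>0$. There exists $\delta'>0$ such that for any $\tau>0$ and any $L_1,L_2\in\mathbb{N}$ there exist $\theta',\theta''\in\ell_2$ such that for any estimator $\tilde d=\tilde d(X)$, $$\mathrm{P}_{\theta'}\big(\tilde d\ge d_\tau(\theta')+L_1\big)+\mathrm{P}_{\theta''}\big(\tilde d\le d_\tau(\theta'')-L_2\big)\ge\delta'.$$
   Context: $\mathbb{N}=\{1,2,\ldots\}$; $\ell_2$ is the space of square-summable real sequences $\theta=(\theta_i)_{i\in\mathbb{N}}$. The noise level $\varepsilon>0$ is fixed and known. Model: the data are $X=(X_i)_{i\in\mathbb{N}}$ with independent $X_i\sim \mathrm{N}(\theta_i,\varepsilon^2)$, where $\theta\in\ell_2$; $\mathrm{P}_\theta$ denotes the law of $X$. Local effective $\tau$-dimension: for $\tau>0$ and $\theta\in\ell_2$, $d_\tau(\theta)\in\mathbb{N}$ is a minimizer over $d\in\mathbb{N}$ of $r_\tau(d,\theta)=\sum_{i>d}\theta_i^2+\tau d\varepsilon^2$ (if there are several minimizers, any fixed choice). An estimator is a (real-valued, in particular possibly $\mathbb{N}$-valued) measurable function of $X$ that does not depend on $\theta$. *)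

theory Defs
  imports "HOL-Probability.Probability"
begin

text \<open>Indices and dimensions start at 1; sequences are indexed by \<open>{1..}\<close> and are
  extensional, so that they carry no spurious 0-th coordinate.\<close>

definition ell2 :: "(nat \<Rightarrow> real) set" where
  "ell2 = {\<theta> \<in> extensional {1..}. (\<lambda>i. (\<theta> i)\<^sup>2) summable_on {1..}}"

text \<open>The second parameter of \<open>normal_density\<close> is the standard deviation.\<close>

definition seq_law :: "real \<Rightarrow> (nat \<Rightarrow> real) \<Rightarrow> (nat \<Rightarrow> real) measure" where
  "seq_law \<epsilon> \<theta> = (\<Pi>\<^sub>M i\<in>{1..}. density lborel (normal_density (\<theta> i) \<epsilon>))"

definition risk :: "real \<Rightarrow> real \<Rightarrow> nat \<Rightarrow> (nat \<Rightarrow> real) \<Rightarrow> real" where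
  "risk \<epsilon> \<tau> d \<theta> = (\<Sum>\<^sub>\<infinity>i\<in>{d<..}. (\<theta> i)\<^sup>2) + \<tau> * real d * \<epsilon>\<^sup>2"

text \<open>The minimizer need not be unique: \<open>d\<close> is an arbitrary selection of minimizers.\<close>

definition effective_dimension :: "real \<Rightarrow> (real \<Rightarrow> (nat \<Rightarrow> real) \<Rightarrow> nat) \<Rightarrow> bool" where
  "effective_dimension \<epsilon> d \<longleftrightarrow>
     (\<forall>\<tau>>0. \<forall>\<theta>\<in>ell2. is_arg_min (\<lambda>k. risk \<epsilon> \<tau> k \<theta>) (\<lambda>k. k \<ge> 1) (d \<tau> \<theta>))"

definition estimator :: "((nat \<Rightarrow> real) \<Rightarrow> real) \<Rightarrow> bool" where
  "estimator T \<longleftrightarrow> T \<in> borel_measurable (\<Pi>\<^sub>M i\<in>{1..}. borel)"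

end

theory Submission
  imports Defs
begin

text \<open>Let \<open>\<theta>\<close> vanish except for one coordinate \<open>b\<close> at position \<open>N + 1\<close>, where \<open>N = L\<^sub>1 + L\<^sub>2\<close>. The
  effective dimension jumps from \<open>1\<close> to \<open>N + 1\<close> as \<open>b\<^sup>2\<close> crosses \<open>N \<tau> \<epsilon>\<^sup>2\<close>. Take a value of \<open>b\<close>
  on either side, both within \<open>\<epsilon>\<close> of the threshold. Both laws then dominate a fixed multiple of
  the law whose coordinate \<open>N + 1\<close> is instead uniform on an interval of length \<open>\<epsilon>\<close>, and under it
  the probabilities of the two events add up to at least 1, since the events cover everything.\<close>

text \<open>Fubini along coordinate \<open>i\<close>: both product measures of \<open>A\<close>
  integrate one and the same slice function, once against \<open>P\<close> and once against
  \<open>Q\<close>, so domination of a single factor passes to the whole product. The index set may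
  be infinite.\<close>

lemma emeasure_PiM_fun_upd_ge:
  assumes M: "\<And>j. j \<in> I \<Longrightarrow> prob_space (M j)" and P: "prob_space P" and Q: "prob_space Q"
    and sets_eq: "sets P = sets Q"
    and le: "\<And>B. B \<in> sets Q \<Longrightarrow> C * emeasure Q B \<le> emeasure P B"
    and i: "i \<in> I" and A: "A \<in> sets (PiM I (M(i := P)))"
  shows "C * emeasure (PiM I (M(i := Q))) A \<le> emeasure (PiM I (M(i := P))) A"
proof -
  let ?J = "I - {i}"
  interpret J: prob_space "PiM ?J M"
    using M by (intro prob_space_PiM) auto
  \<comment> \<open>The slice of \<open>A\<close> at \<open>x\<close> lives on the remaining
    coordinates, so it involves neither \<open>P\<close> nor \<open>Q\<close>.\<close>
  define S where "S x = {X \<in> space (PiM ?J M). X(i := x) \<in> A}" for x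
  have sets_PiM_eq: "sets (PiM I (M(i := Q))) = sets (PiM I (M(i := P)))"
    by (intro sets_PiM_cong) (auto simp: sets_eq)
  \<comment> \<open>\<open>R\<close> will be both \<open>P\<close> and \<open>Q\<close>.\<close>
  have slice: "emeasure (PiM I (M(i := R))) A = (\<integral>\<^sup>+x. emeasure (PiM ?J M) (S x) \<partial>R)"
    and meas: "(\<lambda>x. emeasure (PiM ?J M) (S x)) \<in> borel_measurable R"
    if R: "prob_space R" "sets (PiM I (M(i := R))) = sets (PiM I (M(i := P)))" for R
  proof -
    let ?g = "\<lambda>(x, X). X(i := x)"
    have PiM_J: "PiM ?J (M(i := R)) = PiM ?J M"
      by (intro PiM_cong) auto
    have ins: "insert i ?J = I"
      using i by auto
    have eq: "distr (R \<Otimes>\<^sub>M PiM ?J M) (PiM I (M(i := R))) ?g = PiM I (M(i := R))"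
      using distr_pair_PiM_eq_PiM[of ?J "M(i := R)" i] M R unfolding ins PiM_J
      by (simp add: fun_upd_def)
    have "?g \<in> R \<Otimes>\<^sub>M PiM ?J (M(i := R)) \<rightarrow>\<^sub>M PiM (insert i ?J) (M(i := R))"
      by (simp add: split_beta', rule measurable_fun_upd[where J="?J"]) auto
    then have g: "?g \<in> R \<Otimes>\<^sub>M PiM ?J M \<rightarrow>\<^sub>M PiM I (M(i := R))"
      unfolding ins PiM_J .
    let ?G = "?g -` A \<inter> space (R \<Otimes>\<^sub>M PiM ?J M)"
    have G: "?G \<in> sets (R \<Otimes>\<^sub>M PiM ?J M)"
      using A R(2) by (intro measurable_sets[OF g]) simp
    have S: "Pair x -` ?G = S x" if "x \<in> space R" for x
      using that by (auto simp: S_def space_pair_measure)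
    have "emeasure (PiM I (M(i := R))) A
        = emeasure (distr (R \<Otimes>\<^sub>M PiM ?J M) (PiM I (M(i := R))) ?g) A"
      by (simp only: eq)
    also have "\<dots> = emeasure (R \<Otimes>\<^sub>M PiM ?J M) ?G"
      using g A R by (intro emeasure_distr) auto
    also have "\<dots> = (\<integral>\<^sup>+x. emeasure (PiM ?J M) (S x) \<partial>R)"
      unfolding J.emeasure_pair_measure_alt[OF G] by (intro nn_integral_cong) (simp only: S)
    finally show "emeasure (PiM I (M(i := R))) A = (\<integral>\<^sup>+x. emeasure (PiM ?J M) (S x) \<partial>R)" .
    show "(\<lambda>x. emeasure (PiM ?J M) (S x)) \<in> borel_measurable R"
      using J.measurable_emeasure_Pair[OF G] by (simp only: S cong: measurable_cong)
  qed
  \<comment> \<open>Moving \<open>C\<close> into the measure turns the assumption into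
    \<open>scale_measure C Q \<le> P\<close>, so the integral is monotone in the measure.\<close>
  have "C * emeasure (PiM I (M(i := Q))) A = (\<integral>\<^sup>+x. emeasure (PiM ?J M) (S x) \<partial>scale_measure C Q)"
    using meas[OF Q sets_PiM_eq] by (simp add: slice[OF Q sets_PiM_eq] nn_integral_scale_measure)
  also have "\<dots> \<le> (\<integral>\<^sup>+x. emeasure (PiM ?J M) (S x) \<partial>P)"
    using le sets_eq by (intro nn_integral_mono_measure) (auto simp: le_measure)
  also have "\<dots> = emeasure (PiM I (M(i := P))) A"
    by (simp add: slice[OF P])
  finally show ?thesis .
qed

text \<open>On the interval, \<open>x\<close> and \<open>b\<close> are each within
  \<open>\<epsilon>\<close> of \<open>c\<close>, so the exponent of the normal density is at least
  -2. Its prefactor and the uniform density both scale as \<open>1 / \<epsilon>\<close>, which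
  leaves a ratio free of \<open>\<epsilon>\<close>, \<open>b\<close> and \<open>c\<close>.\<close>

lemma uniform_measure_le_normal:
  fixes \<epsilon> b c :: real
  assumes \<epsilon>: "\<epsilon> > 0" and b: "\<bar>b - c\<bar> \<le> \<epsilon>" and B: "B \<in> sets lborel"
  shows "ennreal (exp (-2) / sqrt (2 * pi)) * emeasure (uniform_measure lborel {c..c + \<epsilon>}) B
    \<le> emeasure (density lborel (normal_density b \<epsilon>)) B"
proof -
  let ?k = "exp (-2) / sqrt (2 * pi)"
  have dens: "ennreal ?k * (indicator {c..c + \<epsilon>} x / emeasure lborel {c..c + \<epsilon>})
      \<le> ennreal (normal_density b \<epsilon> x)" for x
  proof (cases "x \<in> {c..c + \<epsilon>}")
    case True
    then have "\<bar>x - b\<bar> \<le> 2 * \<epsilon>"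
      using b by auto
    then have "(x - b)\<^sup>2 \<le> (2 * \<epsilon>)\<^sup>2"
      using \<epsilon> by (metis abs_le_square_iff abs_of_pos mult_pos_pos zero_less_numeral)
    then have "(x - b)\<^sup>2 / (2 * \<epsilon>\<^sup>2) \<le> 2"
      using \<epsilon> by (simp add: field_simps power2_eq_square)
    then have "exp (-2) \<le> exp (- (x - b)\<^sup>2 / (2 * \<epsilon>\<^sup>2))"
      by simp
    then have "?k / \<epsilon> \<le> normal_density b \<epsilon> x"
      using \<epsilon> by (simp add: normal_density_def real_sqrt_mult divide_simps)
    moreover have "ennreal ?k * (1 / ennreal \<epsilon>) = ennreal (?k / \<epsilon>)"
      using \<epsilon> by (simp add: divide_ennreal ennreal_times_divide del: exp_minus)
    ultimately show ?thesis
      using True \<epsilon> by (simp add: ennreal_leI)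
  qed simp
  have "ennreal ?k * emeasure (uniform_measure lborel {c..c + \<epsilon>}) B
      = (\<integral>\<^sup>+x. ennreal ?k * (indicator {c..c + \<epsilon>} x / emeasure lborel {c..c + \<epsilon>} * indicator B x)
          \<partial>lborel)"
    using B by (subst nn_integral_cmult) (auto simp: uniform_measure_def emeasure_density)
  also have "\<dots> \<le> (\<integral>\<^sup>+x. ennreal (normal_density b \<epsilon> x) * indicator B x \<partial>lborel)"
    using dens by (intro nn_integral_mono) (auto simp: indicator_def)
  also have "\<dots> = emeasure (density lborel (normal_density b \<epsilon>)) B"
    using B by (simp add: emeasure_density)
  finally show ?thesis .
qed

text \<open>The restriction to \<open>{1..}\<close> makes the sequence extensional, as membership in
  \<open>ell2\<close> demands.\<close>

definition spike :: "nat \<Rightarrow> real \<Rightarrow> nat \<Rightarrow> real" where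
  "spike m b = (\<lambda>i\<in>{1..}. if i = m then b else 0)"

lemma spike_in_ell2: "spike m b \<in> ell2"
proof -
  have "(\<lambda>i. (spike m b i)\<^sup>2) summable_on {1..}"
    by (rule finite_nonzero_values_imp_summable_on, rule finite_subset[of _ "{m}"])
       (auto simp: spike_def)
  then show ?thesis
    by (simp add: ell2_def spike_def)
qed

lemma risk_spike:
  assumes "m \<ge> 1"
  shows "risk \<epsilon> \<tau> k (spike m b) = (if k < m then b\<^sup>2 else 0) + \<tau> * real k * \<epsilon>\<^sup>2"
proof -
  have "(\<Sum>\<^sub>\<infinity>i\<in>{k<..}. (spike m b i)\<^sup>2) = (\<Sum>\<^sub>\<infinity>i\<in>{m} \<inter> {k<..}. b\<^sup>2)"
    by (rule infsum_cong_neutral) (use assms in \<open>auto simp: spike_def\<close>)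
  then show ?thesis
    by (simp add: risk_def)
qed

text \<open>As a function of the dimension the risk has slope
  \<open>\<tau> * \<epsilon>\<^sup>2\<close>, apart from a drop by \<open>b\<^sup>2\<close> on
  reaching \<open>Suc N\<close>. Only 1 and \<open>Suc N\<close> can be minimizers, and a strict
  inequality makes the minimizer unique, so the selection \<open>d\<close> has no choice.\<close>

lemma
  assumes d: "effective_dimension \<epsilon> d" and \<epsilon>: "\<epsilon> > 0" and \<tau>: "\<tau> > 0"
  shows effective_dimension_spike_small:
      "b\<^sup>2 < real N * \<tau> * \<epsilon>\<^sup>2 \<Longrightarrow> d \<tau> (spike (Suc N) b) = 1"
    and effective_dimension_spike_large:
      "b\<^sup>2 > real N * \<tau> * \<epsilon>\<^sup>2 \<Longrightarrow> d \<tau> (spike (Suc N) b) = Suc N"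
proof -
  let ?k = "d \<tau> (spike (Suc N) b)" and ?t = "\<tau> * \<epsilon>\<^sup>2"
  have t: "?t > 0"
    using \<epsilon> \<tau> by simp
  have k: "?k \<ge> 1"
    and min: "\<And>j. j \<ge> 1 \<Longrightarrow>
      risk \<epsilon> \<tau> ?k (spike (Suc N) b) \<le> risk \<epsilon> \<tau> j (spike (Suc N) b)"
    using d \<tau> spike_in_ell2[of "Suc N" b]
    by (auto simp: effective_dimension_def is_arg_min_def not_less)
  have le: "(if ?k < Suc N then b\<^sup>2 else 0) + real ?k * ?t
      \<le> (if j < Suc N then b\<^sup>2 else 0) + real j * ?t" if "j \<ge> 1" for j
    using min[OF that] by (simp only: risk_spike le_add1 plus_1_eq_Suc[symmetric] mult_ac)
  have mono: "real i * ?t \<le> real j * ?t \<longleftrightarrow> i \<le> j" for i j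
    using t by (simp add: mult_le_cancel_right)
  show "?k = 1" if "b\<^sup>2 < real N * \<tau> * \<epsilon>\<^sup>2"
  proof (cases "?k < Suc N")
    case True
    then have "real ?k * ?t \<le> real 1 * ?t"
      using le[of 1] k by auto
    then show ?thesis
      using k unfolding mono by simp
  next
    case False
    then have "real (Suc N) * ?t \<le> real ?k * ?t"
      by (subst mono) simp
    \<comment> \<open>For \<open>N = 0\<close> dimension 1 already captures the spike and has risk
      \<open>?t\<close>; otherwise its risk is \<open>b\<^sup>2 + ?t\<close>.\<close>
    moreover have "real ?k * ?t \<le> b\<^sup>2 + ?t"
      using False le[of 1] by (cases "N = 0") (simp_all add: add_increasing)
    ultimately show ?thesis
      using that by (simp add: algebra_simps)
  qed
  show "?k = Suc N" if "b\<^sup>2 > real N * \<tau> * \<epsilon>\<^sup>2"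
  proof (cases "?k < Suc N")
    \<comment> \<open>Contradictory: the spike is missed, so the risk is at least
      \<open>b\<^sup>2 + ?t\<close>, above the risk at \<open>Suc N\<close>.\<close>
    case True
    have "real 1 * ?t \<le> real ?k * ?t"
      using k by (subst mono)
    then show ?thesis
      using True that le[of "Suc N"] by (simp add: algebra_simps)
  next
    case False
    then have "real ?k * ?t \<le> real (Suc N) * ?t"
      using le[of "Suc N"] by auto
    then show ?thesis
      using False by (subst (asm) mono) simp
  qed
qed

theorem theorem3:
  fixes \<epsilon> :: real and d :: "real \<Rightarrow> (nat \<Rightarrow> real) \<Rightarrow> nat"
  assumes "\<epsilon> > 0"
    and "effective_dimension \<epsilon> d"
  shows "\<exists>\<delta>>0. \<forall>\<tau>>0. \<forall>L\<^sub>1\<ge>1. \<forall>L\<^sub>2\<ge>1. \<exists>\<theta>'\<in>ell2. \<exists>\<theta>''\<in>ell2. \<forall>T. estimator T \<longrightarrow>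
           \<P>(x in seq_law \<epsilon> \<theta>'. T x \<ge> real (d \<tau> \<theta>') + real (L\<^sub>1::nat)) +
           \<P>(x in seq_law \<epsilon> \<theta>''. T x \<le> real (d \<tau> \<theta>'') - real (L\<^sub>2::nat)) \<ge> \<delta>"
proof -
  define \<delta> :: real where "\<delta> = exp (-2) / sqrt (2 * pi)"
  have \<delta>: "\<delta> > 0"
    by (simp add: \<delta>_def)
  have "\<exists>\<theta>'\<in>ell2. \<exists>\<theta>''\<in>ell2. \<forall>T. estimator T \<longrightarrow>
           \<P>(x in seq_law \<epsilon> \<theta>'. T x \<ge> real (d \<tau> \<theta>') + real L\<^sub>1) +
           \<P>(x in seq_law \<epsilon> \<theta>''. T x \<le> real (d \<tau> \<theta>'') - real L\<^sub>2) \<ge> \<delta>"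
    if \<tau>: "\<tau> > 0" and L: "L\<^sub>1 \<ge> 1" "L\<^sub>2 \<ge> 1" for \<tau> and L\<^sub>1 L\<^sub>2 :: nat
  proof -
    \<comment> \<open>With dimensions 1 and \<open>Suc N\<close>, this choice makes both thresholds
      for \<open>T\<close> equal: \<open>Suc N - L\<^sub>2 = 1 + L\<^sub>1\<close>.\<close>
    define N where "N = L\<^sub>1 + L\<^sub>2"
    define c where "c = sqrt (real N * \<tau>) * \<epsilon>"
    \<comment> \<open>The spikes will be \<open>c - h\<close> and \<open>c + h\<close>, around the
      critical height \<open>c\<close>. The bound \<open>h \<le> \<epsilon>\<close> allows the
      comparison with the uniform law; \<open>h \<le> c\<close> keeps \<open>c - h\<close>
      nonnegative, so that squaring preserves the order.\<close>
    define h where "h = min c \<epsilon>"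
    have N: "real N > 0"
      using L by (simp add: N_def)
    have c: "c > 0" "c\<^sup>2 = real N * \<tau> * \<epsilon>\<^sup>2"
      using N \<tau> \<open>\<epsilon> > 0\<close> by (simp_all add: c_def power_mult_distrib)
    have h: "0 < h" "h \<le> c" "h \<le> \<epsilon>"
      using c \<open>\<epsilon> > 0\<close> by (simp_all add: h_def)
    let ?M = "\<lambda>i::nat. density lborel (normal_density 0 \<epsilon>)"
    let ?U = "uniform_measure lborel {c..c + \<epsilon>}"
    define Q where "Q = PiM {1..} (?M(Suc N := ?U))"
    have U: "prob_space ?U"
      using \<open>\<epsilon> > 0\<close> by (intro prob_space_uniform_measure) auto
    interpret Q: prob_space Q
      unfolding Q_def using U prob_space_normal_density \<open>\<epsilon> > 0\<close>
      by (intro prob_space_PiM) auto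
    \<comment> \<open>All spikes share the same noise law outside coordinate \<open>Suc N\<close>,
      so only that factor has to be compared with \<open>?U\<close>.\<close>
    have law: "seq_law \<epsilon> (spike (Suc N) b)
        = PiM {1..} (?M(Suc N := density lborel (normal_density b \<epsilon>)))" for b
      unfolding seq_law_def by (intro PiM_cong) (auto simp: spike_def)
    have sets_law: "sets (seq_law \<epsilon> \<theta>) = sets (PiM {1..} (\<lambda>i. borel))" for \<theta>
      unfolding seq_law_def by (intro sets_PiM_cong) auto
    have sets_Q: "sets Q = sets (PiM {1..} (\<lambda>i. borel))"
      unfolding Q_def by (intro sets_PiM_cong) auto
    have dom: "\<delta> * measure Q A \<le> measure (seq_law \<epsilon> (spike (Suc N) b)) A"
      if b: "\<bar>b - c\<bar> \<le> \<epsilon>" and A: "A \<in> sets Q" for b A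
    proof -
      interpret P: prob_space "seq_law \<epsilon> (spike (Suc N) b)"
        unfolding seq_law_def using prob_space_normal_density \<open>\<epsilon> > 0\<close>
        by (intro prob_space_PiM) auto
      have "ennreal \<delta> * emeasure Q A \<le> emeasure (seq_law \<epsilon> (spike (Suc N) b)) A"
        unfolding law Q_def \<delta>_def
      proof (rule emeasure_PiM_fun_upd_ge)
        show "A \<in> sets (PiM {1..} (?M(Suc N := density lborel (normal_density b \<epsilon>))))"
          using A unfolding law[symmetric] sets_law sets_Q .
      qed (use U prob_space_normal_density[OF \<open>\<epsilon> > 0\<close>] uniform_measure_le_normal[OF \<open>\<epsilon> > 0\<close> b]
            in auto)
      then show ?thesis
        using \<delta> by (simp add: P.emeasure_eq_measure Q.emeasure_eq_measure ennreal_mult'[symmetric])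
    qed
    let ?\<theta>1 = "spike (Suc N) (c - h)" and ?\<theta>2 = "spike (Suc N) (c + h)"
    have "(c - h)\<^sup>2 < c\<^sup>2" "c\<^sup>2 < (c + h)\<^sup>2"
      using c(1) h by (intro power_strict_mono; simp)+
    then have dims: "d \<tau> ?\<theta>1 = 1" "d \<tau> ?\<theta>2 = Suc N"
      using effective_dimension_spike_small[OF \<open>effective_dimension \<epsilon> d\<close> \<open>\<epsilon> > 0\<close> \<tau>]
        effective_dimension_spike_large[OF \<open>effective_dimension \<epsilon> d\<close> \<open>\<epsilon> > 0\<close> \<tau>]
      by (simp_all add: c)
    have "\<delta> \<le> \<P>(x in seq_law \<epsilon> ?\<theta>1. T x \<ge> real (d \<tau> ?\<theta>1) + real L\<^sub>1)
        + \<P>(x in seq_law \<epsilon> ?\<theta>2. T x \<le> real (d \<tau> ?\<theta>2) - real L\<^sub>2)" if "estimator T" for T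
    proof -
      have spc: "space (seq_law \<epsilon> \<theta>) = space Q" for \<theta>
        using sets_law sets_Q by (intro sets_eq_imp_space_eq) simp
      have [measurable]: "T \<in> borel_measurable Q"
        using that sets_Q by (simp add: estimator_def cong: measurable_cong_sets)
      \<comment> \<open>These are the two error events, with the common threshold inserted; together
        they exhaust the space for any real-valued \<open>T\<close>.\<close>
      let ?A = "{x \<in> space Q. T x \<ge> 1 + real L\<^sub>1}" and ?B = "{x \<in> space Q. T x \<le> 1 + real L\<^sub>1}"
      have "1 = measure Q (?A \<union> ?B)"
        by (subst Q.prob_space[symmetric]) (rule arg_cong[where f = "measure Q"], auto)
      also have "\<dots> \<le> measure Q ?A + measure Q ?B"
        by (intro measure_Un_le) auto
      finally have "\<delta> \<le> \<delta> * measure Q ?A + \<delta> * measure Q ?B"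
        using \<delta> by (simp add: distrib_left[symmetric])
      also have "\<dots> \<le> measure (seq_law \<epsilon> ?\<theta>1) ?A + measure (seq_law \<epsilon> ?\<theta>2) ?B"
        using h by (intro add_mono dom) auto
      finally show ?thesis
        unfolding dims spc by (simp add: N_def)
    qed
    then show ?thesis
      using spike_in_ell2 by blast
  qed
  then show ?thesis
    using \<delta> by blast
qed

end
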